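(* Let $l\ge 3$ be an odd integer. Let $\mathcal K_l$ be the class of all countable even-odd metric spaces $(S,d)$ in which there are no $x,y\in S$ with $d(x,y)=(a,b)$ and $a+b\le l$, and let $\mathbb U_l=(U_l,d_l)$ be the generic even-odd metric space for $\mathcal K_l$ (a member of $\mathcal K_l$ that is ultrahomogeneous and into which every member of $\mathcal K_l$ embeds). Let $G_l=(U_l,E_l)$ be the graph with $\{x,y\}\in E_l$ if and only if $d_l(x,y)=(a,1)$ for some $a$. Then $G_l$ is a universal graph for the class $\mathrm{Forb}_h(C_l)$, i.e. $G_l$ contains no homomorphic image of the cycle $C_l$ and every countable graph containing no homomorphic image of $C_l$ is isomorphic to a subgraph of $G_l$.
   Context: An even-odd pair is $(a,b)$ with $a$ an even non-negative integer or $\omega$ and $b$ an odd positive integer or $\omega$; $(a,b)\le(c,d)$ iff $a\le c$ and $b\le d$; $(a,b)+(c,d)=(\min(a+c,b+d),\min(a+d,b+c))$ with $x+\omega=\omega$. An even-odd metric space is a set $S$ with $d$ from $S\times S$ to even-odd pairs such that $d(x,y)=(0,b)$ for some $b$ iff $x=y$, $d$ is symmetric, and $d(x,z)\le d(x,y)+d(y,z)$. Embeddings are injective distance-preserving maps; ultrahomogeneity means every distance-preserving bijection between finite subspaces extends to one of the whole space. $C_l$ is the cycle of length $l$; $\mathrm{Forb}_h(C_l)$ is the class of countable graphs admitting no homomorphism from $C_l$ (equivalently, containing no odd cycle of length at most $l$). *)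

theory Defs
  imports "HOL-Library.Extended_Nat" "HOL-Library.Countable_Set" "HOL-Library.FuncSet"
begin

section \<open>Even-odd pairs\<close>

text \<open>The symbol \<open>\<omega>\<close> of the paper is \<open>\<infinity> :: enat\<close>; in particular \<open>x + \<infinity> = \<infinity>\<close> and
  \<open>min x \<infinity> = x\<close>.\<close>

type_synonym eo_pair = "enat \<times> enat"

definition even_odd_pair :: "eo_pair \<Rightarrow> bool" where
  "even_odd_pair p \<longleftrightarrow>
     (fst p = \<infinity> \<or> (\<exists>n. even n \<and> fst p = enat n)) \<and>
     (snd p = \<infinity> \<or> (\<exists>n. odd n \<and> snd p = enat n))"

definition eo_le :: "eo_pair \<Rightarrow> eo_pair \<Rightarrow> bool" where
  "eo_le p q \<longleftrightarrow> fst p \<le> fst q \<and> snd p \<le> snd q"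

definition eo_add :: "eo_pair \<Rightarrow> eo_pair \<Rightarrow> eo_pair" where
  "eo_add p q =
     (min (fst p + fst q) (snd p + snd q), min (fst p + snd q) (snd p + fst q))"


section \<open>Even-odd metric spaces\<close>

text \<open>A space is given by a carrier \<open>S\<close> and a function \<open>d\<close> whose values outside \<open>S \<times> S\<close> are
  irrelevant.  The self-distance \<open>d x x\<close> is \<open>(0, b)\<close> with \<open>b\<close> possibly depending on \<open>x\<close>, so
  distance preservation below is not vacuous on the diagonal.\<close>

locale even_odd_metric_space =
  fixes S :: "'a set" and d :: "'a \<Rightarrow> 'a \<Rightarrow> eo_pair"
  assumes dist_pair: "\<lbrakk>x \<in> S; y \<in> S\<rbrakk> \<Longrightarrow> even_odd_pair (d x y)"
    and dist_zero_iff: "\<lbrakk>x \<in> S; y \<in> S\<rbrakk> \<Longrightarrow> (\<exists>b. d x y = (0, b)) \<longleftrightarrow> x = y"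
    and dist_sym: "\<lbrakk>x \<in> S; y \<in> S\<rbrakk> \<Longrightarrow> d x y = d y x"
    and dist_triangle: "\<lbrakk>x \<in> S; y \<in> S; z \<in> S\<rbrakk> \<Longrightarrow> eo_le (d x z) (eo_add (d x y) (d y z))"

definition dist_preserving ::
    "'a set \<Rightarrow> ('a \<Rightarrow> 'a \<Rightarrow> eo_pair) \<Rightarrow> ('b \<Rightarrow> 'b \<Rightarrow> eo_pair) \<Rightarrow> ('a \<Rightarrow> 'b) \<Rightarrow> bool" where
  "dist_preserving A d d' f \<longleftrightarrow> (\<forall>x\<in>A. \<forall>y\<in>A. d' (f x) (f y) = d x y)"

definition eo_embedding ::
    "'a set \<Rightarrow> ('a \<Rightarrow> 'a \<Rightarrow> eo_pair) \<Rightarrow> 'b set \<Rightarrow> ('b \<Rightarrow> 'b \<Rightarrow> eo_pair) \<Rightarrow> ('a \<Rightarrow> 'b) \<Rightarrow> bool" where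
  "eo_embedding S d T d' f \<longleftrightarrow> f \<in> S \<rightarrow> T \<and> inj_on f S \<and> dist_preserving S d d' f"

definition ultrahomogeneous :: "'a set \<Rightarrow> ('a \<Rightarrow> 'a \<Rightarrow> eo_pair) \<Rightarrow> bool" where
  "ultrahomogeneous S d \<longleftrightarrow>
     (\<forall>A B f. finite A \<and> A \<subseteq> S \<and> finite B \<and> B \<subseteq> S \<and>
        bij_betw f A B \<and> dist_preserving A d d f \<longrightarrow>
        (\<exists>g. bij_betw g S S \<and> dist_preserving S d d g \<and> (\<forall>x\<in>A. g x = f x)))"

definition K_class :: "nat \<Rightarrow> 'a set \<Rightarrow> ('a \<Rightarrow> 'a \<Rightarrow> eo_pair) \<Rightarrow> bool" where
  "K_class l S d \<longleftrightarrow>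
     countable S \<and> even_odd_metric_space S d \<and>
     \<not> (\<exists>x\<in>S. \<exists>y\<in>S. \<exists>a b. d x y = (a, b) \<and> a + b \<le> enat l)"

text \<open>HOL cannot quantify over types inside a definition, so the members of the class that have to
  embed range over the spaces whose carrier is a set of natural numbers.  Every countable space is
  isometric to one of these; the lemma \<open>generic_space_embeds\<close> below derives the embedding property
  for carriers in an arbitrary type.\<close>

definition generic_space :: "nat \<Rightarrow> 'a set \<Rightarrow> ('a \<Rightarrow> 'a \<Rightarrow> eo_pair) \<Rightarrow> bool" where
  "generic_space l U d \<longleftrightarrow>
     K_class l U d \<and> ultrahomogeneous U d \<and>
     (\<forall>(S :: nat set) d'. K_class l S d' \<longrightarrow> (\<exists>f. eo_embedding S d' U d f))"

lemma generic_space_embeds: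
  fixes S :: "'b set" and U :: "'a set"
  assumes gen: "generic_space l U d" and K: "K_class l S d'"
  shows "\<exists>f. eo_embedding S d' U d f"
proof -
  define g where "g = to_nat_on S"
  define h where "h = the_inv_into S g"
  have inj: "inj_on g S"
    using K by (simp add: K_class_def g_def inj_on_to_nat_on)
  have hg: "h (g x) = x" if "x \<in> S" for x
    using inj that by (simp add: h_def the_inv_into_f_f)
  define e where "e m n = d' (h m) (h n)" for m n
  interpret even_odd_metric_space S d'
    using K by (simp add: K_class_def)
  have "even_odd_metric_space (g ` S) e"
  proof
    fix x y z assume "x \<in> g ` S" "y \<in> g ` S" "z \<in> g ` S"
    then show "eo_le (e x z) (eo_add (e x y) (e y z))"
      by (auto simp: e_def hg intro: dist_triangle)
  next
    fix x y assume "x \<in> g ` S" "y \<in> g ` S"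
    then obtain u v where uv: "u \<in> S" "v \<in> S" "x = g u" "y = g v" by blast
    show "even_odd_pair (e x y)"
      using uv by (simp add: e_def hg dist_pair)
    show "(\<exists>b. e x y = (0, b)) \<longleftrightarrow> x = y"
      using uv inj dist_zero_iff[of u v] by (simp add: e_def hg inj_on_eq_iff)
    show "e x y = e y x"
      using uv dist_sym[of u v] by (simp add: e_def hg)
  qed
  then have "K_class l (g ` S) e"
    using K by (auto simp: K_class_def e_def hg)
  then obtain f where "eo_embedding (g ` S) e U d f"
    using gen by (auto simp: generic_space_def)
  then have "eo_embedding S d' U d (f \<circ> g)"
    using inj by (auto simp: eo_embedding_def dist_preserving_def e_def hg
        intro: comp_inj_on)
  then show ?thesis by blast
qed


section \<open>Graphs\<close>

definition simple_graph :: "'a set \<Rightarrow> 'a set set \<Rightarrow> bool" where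
  "simple_graph V E \<longleftrightarrow> (\<forall>e\<in>E. \<exists>x\<in>V. \<exists>y\<in>V. x \<noteq> y \<and> e = {x, y})"

definition graph_hom ::
    "'a set \<Rightarrow> 'a set set \<Rightarrow> 'b set \<Rightarrow> 'b set set \<Rightarrow> ('a \<Rightarrow> 'b) \<Rightarrow> bool" where
  "graph_hom V E W F f \<longleftrightarrow>
     f \<in> V \<rightarrow> W \<and> (\<forall>x\<in>V. \<forall>y\<in>V. {x, y} \<in> E \<longrightarrow> {f x, f y} \<in> F)"

definition graph_iso ::
    "'a set \<Rightarrow> 'a set set \<Rightarrow> 'b set \<Rightarrow> 'b set set \<Rightarrow> ('a \<Rightarrow> 'b) \<Rightarrow> bool" where
  "graph_iso V E W F f \<longleftrightarrow>
     bij_betw f V W \<and> (\<forall>x\<in>V. \<forall>y\<in>V. {x, y} \<in> E \<longleftrightarrow> {f x, f y} \<in> F)"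

text \<open>Subgraphs need not be induced.\<close>

definition subgraph :: "'a set \<Rightarrow> 'a set set \<Rightarrow> 'a set \<Rightarrow> 'a set set \<Rightarrow> bool" where
  "subgraph W F V E \<longleftrightarrow> simple_graph W F \<and> W \<subseteq> V \<and> F \<subseteq> E"

definition cycle_verts :: "nat \<Rightarrow> nat set" where
  "cycle_verts l = {..<l}"

definition cycle_edges :: "nat \<Rightarrow> nat set set" where
  "cycle_edges l = {{i, (i + 1) mod l} | i. i < l}"

definition Forb_h_cycle :: "nat \<Rightarrow> 'a set \<Rightarrow> 'a set set \<Rightarrow> bool" where
  "Forb_h_cycle l V E \<longleftrightarrow>
     countable V \<and> simple_graph V E \<and>
     \<not> (\<exists>f. graph_hom (cycle_verts l) (cycle_edges l) V E f)"

definition dist_one_edges :: "'a set \<Rightarrow> ('a \<Rightarrow> 'a \<Rightarrow> eo_pair) \<Rightarrow> 'a set set" where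
  "dist_one_edges U d = {{x, y} | x y. x \<in> U \<and> y \<in> U \<and> (\<exists>a. d x y = (a, 1))}"

end

theory Submission
  imports Defs
begin

text \<open>
  Taking lengths of (shortest even walk, shortest odd walk) makes every graph an even-odd metric
  space, whose pairs at distance \<open>(a, 1)\<close> are the edges. A pair at distance \<open>(a, b)\<close> lies on a
  closed walk of odd length \<open>a + b\<close>; going back and forth along one edge pads a closed walk of odd
  length at most \<open>l\<close> to length exactly \<open>l\<close>, that is, to a homomorphic image of \<open>C\<^sub>l\<close>. Hence
  graphs in \<open>Forb\<^sub>h(C\<^sub>l)\<close> give members of \<open>K\<^sub>l\<close>, which embed into \<open>U\<^sub>l\<close>. Conversely, by the triangle
  inequality a walk of length \<open>n\<close> in \<open>G\<^sub>l\<close> bounds the component of the distance of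
  the parity of \<open>n\<close>, so a closed walk of length \<open>l\<close> gives a self-distance \<open>(0, b)\<close> with \<open>b \<le> l\<close>.
\<close>

section \<open>Closed walks and homomorphic images of cycles\<close>

text \<open>As a relation on ordered pairs, adjacency lets a walk of length \<open>n\<close> from
  \<open>x\<close> to \<open>y\<close> be written \<open>(x, y) \<in> adj E ^^ n\<close>.\<close>

definition adj :: "'a set set \<Rightarrow> ('a \<times> 'a) set" where
  "adj E = {(x, y). {x, y} \<in> E}"

lemma sym_adj: "sym (adj E)"
  by (auto simp: sym_def adj_def insert_commute)

lemma relpow_sym:
  assumes "sym R" "(x, y) \<in> R ^^ n"
  shows "(y, x) \<in> R ^^ n"
  using assms(2)
proof (induction n arbitrary: y)
  case (Suc n)
  then obtain z where "(x, z) \<in> R ^^ n" "(z, y) \<in> R" by auto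
  then show ?case
    using Suc.IH assms(1) by (meson relpow_Suc_I2 symD)
qed simp

lemma adj_in_verts: "x \<in> V \<and> y \<in> V" if "simple_graph V E" "(x, y) \<in> adj E"
  using that by (fastforce simp: simple_graph_def adj_def doubleton_eq_iff)

text \<open>The images of the vertices \<open>0, ..., l - 1\<close> of the cycle, followed by the
  image of \<open>0\<close> again, are the successive vertices of a closed walk, and conversely.
  Simplicity of the graph places the vertices of the walk in \<open>V\<close>.\<close>

lemma cycle_hom_iff_closed_walk:
  assumes "simple_graph V E" "l > 0"
  shows "(\<exists>f. graph_hom (cycle_verts l) (cycle_edges l) V E f) \<longleftrightarrow> (\<exists>x. (x, x) \<in> adj E ^^ l)"
proof
  assume "\<exists>f. graph_hom (cycle_verts l) (cycle_edges l) V E f"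
  then obtain f where f: "graph_hom (cycle_verts l) (cycle_edges l) V E f" by blast
  have "(f (i mod l), f (Suc i mod l)) \<in> adj E" if "i < l" for i
  proof -
    have "{i, Suc i mod l} \<in> cycle_edges l"
      using that by (auto simp: cycle_edges_def)
    then show ?thesis
      using f that by (simp add: graph_hom_def cycle_verts_def adj_def)
  qed
  then have "(f 0, f 0) \<in> adj E ^^ l"
    unfolding relpow_fun_conv by (intro exI[of _ "\<lambda>i. f (i mod l)"]) auto
  then show "\<exists>x. (x, x) \<in> adj E ^^ l" ..
next
  assume "\<exists>x. (x, x) \<in> adj E ^^ l"
  then obtain f where f: "f l = f 0" "\<And>i. i < l \<Longrightarrow> (f i, f (Suc i)) \<in> adj E"
    by (auto simp: relpow_fun_conv)
  \<comment> \<open>Only the last index \<open>i = l - 1\<close> wraps around to \<open>0\<close>;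
    there \<open>f l = f 0\<close> closes the walk.\<close>
  have step: "{f i, f ((i + 1) mod l)} \<in> E" if "i < l" for i
  proof (cases "Suc i = l")
    case True
    then show ?thesis using f(1) f(2)[of i] that by (simp add: adj_def)
  next
    case False
    then show ?thesis using f(2)[of i] that by (simp add: adj_def)
  qed
  have "graph_hom (cycle_verts l) (cycle_edges l) V E f"
    unfolding graph_hom_def
  proof (intro conjI ballI impI)
    show "f \<in> cycle_verts l \<rightarrow> V"
      using f(2) adj_in_verts[OF assms(1)] by (auto simp: cycle_verts_def)
  next
    fix x y assume "{x, y} \<in> cycle_edges l"
    then obtain i where "i < l" "{x, y} = {i, (i + 1) mod l}"
      by (auto simp: cycle_edges_def)
    then show "{f x, f y} \<in> E"
      using step[of i] by (auto simp: doubleton_eq_iff insert_commute)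
  qed
  then show "\<exists>f. graph_hom (cycle_verts l) (cycle_edges l) V E f" by blast
qed

lemma closed_walk_pad:
  assumes "sym R" "(x, x) \<in> R ^^ m" "odd m" "odd l" "m \<le> l"
  shows "(x, x) \<in> R ^^ l"
proof -
  \<comment> \<open>Being odd, \<open>m\<close> is positive, so the walk has a first edge to go back
    and forth along.\<close>
  obtain y where "(x, y) \<in> R"
    using assms(2,3) by (metis odd_pos gr0_conv_Suc relpow_Suc_D2)
  then have two: "(x, x) \<in> R ^^ 2"
    using assms(1) by (auto simp: numeral_2_eq_2 dest: symD)
  have even: "(x, x) \<in> R ^^ (2 * k)" for k
  proof (induction k)
    case (Suc k)
    have "(x, x) \<in> R ^^ (2 * k) O R ^^ 2"
      using Suc two by blast
    then show ?case by (simp only: relpow_add[symmetric] mult_Suc_right add.commute)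
  qed simp
  obtain k where "l = m + 2 * k"
    using assms(3-5) by (metis dvdE even_diff_nat le_add_diff_inverse odd_even_add)
  then show ?thesis
    using assms(2) even[of k] by (auto simp: relpow_add)
qed

section \<open>The even-odd metric of a graph\<close>

text \<open>The infimum over the empty set is \<open>\<infinity>\<close>, the distance when there is no walk of the given
  parity (\<open>b\<close> means odd).\<close>

definition walk_len :: "'a set set \<Rightarrow> bool \<Rightarrow> 'a \<Rightarrow> 'a \<Rightarrow> enat" where
  "walk_len E b x y = Inf (enat ` {n. odd n = b \<and> (x, y) \<in> adj E ^^ n})"

definition walk_dist :: "'a set set \<Rightarrow> 'a \<Rightarrow> 'a \<Rightarrow> eo_pair" where
  "walk_dist E x y = (walk_len E False x y, walk_len E True x y)"

text \<open>The infimum of a nonempty set of naturals is attained, so every finite value is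
  witnessed by a shortest walk of the right parity.\<close>

lemma walk_len_cases:
  obtains "walk_len E b x y = \<infinity>"
  | n where "walk_len E b x y = enat n" "odd n = b" "(x, y) \<in> adj E ^^ n"
proof (cases "{n. odd n = b \<and> (x, y) \<in> adj E ^^ n} = {}")
  case True
  then have "walk_len E b x y = \<infinity>"
    unfolding walk_len_def by (simp only: image_empty Inf_empty top_enat_def)
  then show ?thesis by (rule that(1))
next
  case False
  then obtain n where "n \<in> {n. odd n = b \<and> (x, y) \<in> adj E ^^ n}" by blast
  then have "walk_len E b x y \<in> enat ` {n. odd n = b \<and> (x, y) \<in> adj E ^^ n}"
    unfolding walk_len_def by (intro wellorder_InfI[OF imageI])
  then show ?thesis using that(2) by blast
qed

lemma walk_len_le: "(x, y) \<in> adj E ^^ n \<Longrightarrow> odd n = b \<Longrightarrow> walk_len E b x y \<le> enat n"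
  unfolding walk_len_def by (auto intro: Inf_lower)

lemma walk_len_sym: "walk_len E b x y = walk_len E b y x"
proof -
  have "(x, y) \<in> adj E ^^ n \<longleftrightarrow> (y, x) \<in> adj E ^^ n" for n
    by (rule iffI; erule relpow_sym[OF sym_adj])
  then show ?thesis by (simp only: walk_len_def)
qed

text \<open>Shortest walks are concatenated. With \<open>True\<close> standing for odd, the parity
  of the sum is the exclusive or of the parities, which is \<open>b \<noteq> c\<close>.\<close>

lemma walk_len_triangle: "walk_len E (b \<noteq> c) x z \<le> walk_len E b x y + walk_len E c y z"
proof (cases rule: walk_len_cases[of E b x y]; cases rule: walk_len_cases[of E c y z])
  fix m n
  assume mn: "walk_len E b x y = enat m" "odd m = b" "(x, y) \<in> adj E ^^ m"
    "walk_len E c y z = enat n" "odd n = c" "(y, z) \<in> adj E ^^ n"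
  then have "(x, z) \<in> adj E ^^ (m + n)"
    by (auto simp: relpow_add)
  then have "walk_len E (b \<noteq> c) x z \<le> enat (m + n)"
    by (rule walk_len_le) (use mn in auto)
  then show ?thesis using mn by simp
qed simp_all

lemma walk_len_even_zero_iff: "walk_len E False x y = 0 \<longleftrightarrow> x = y"
proof
  assume "walk_len E False x y = 0"
  then show "x = y"
    by (cases rule: walk_len_cases[of E False x y]) (auto simp: zero_enat_def)
next
  assume "x = y"
  then have "walk_len E False x y \<le> enat 0"
    by (intro walk_len_le) auto
  then show "walk_len E False x y = 0" by (simp flip: zero_enat_def)
qed

lemma walk_len_odd_one: "{x, y} \<in> E \<Longrightarrow> walk_len E True x y = 1"
proof -
  assume "{x, y} \<in> E"
  then have "walk_len E True x y \<le> enat 1"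
    by (intro walk_len_le) (auto simp: adj_def)
  then show ?thesis
    by (cases rule: walk_len_cases[of E True x y]) (auto simp: one_enat_def le_Suc_eq)
qed

lemma even_odd_metric_space_walk_dist: "even_odd_metric_space V (walk_dist E)"
proof
  fix x y z
  show "even_odd_pair (walk_dist E x y)"
    unfolding even_odd_pair_def walk_dist_def
    by (cases rule: walk_len_cases[of E False x y]; cases rule: walk_len_cases[of E True x y]) auto
  show "(\<exists>b. walk_dist E x y = (0, b)) \<longleftrightarrow> x = y"
    by (simp add: walk_dist_def walk_len_even_zero_iff)
  show "walk_dist E x y = walk_dist E y x"
    by (simp add: walk_dist_def walk_len_sym[of E _ x y])
  show "eo_le (walk_dist E x z) (eo_add (walk_dist E x y) (walk_dist E y z))"
    unfolding eo_le_def eo_add_def walk_dist_def fst_conv snd_conv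
    \<comment> \<open>The two minima in \<open>eo_add\<close> have four terms, one for each choice
      of parities of the two walks.\<close>
    using walk_len_triangle[of E False False x z y] walk_len_triangle[of E True True x z y]
      walk_len_triangle[of E False True x z y] walk_len_triangle[of E True False x z y]
    by (intro conjI min.boundedI) simp_all
qed

lemma K_class_walk_dist:
  assumes "odd l" "Forb_h_cycle l V E"
  shows "K_class l V (walk_dist E)"
proof -
  have False if le: "walk_len E False x y + walk_len E True x y \<le> enat l" for x y
  proof -
    obtain m where m: "walk_len E False x y = enat m" "even m" "(x, y) \<in> adj E ^^ m"
      using le by (cases rule: walk_len_cases[of E False x y]) auto
    obtain n where n: "walk_len E True x y = enat n" "odd n" "(x, y) \<in> adj E ^^ n"
      using le by (cases rule: walk_len_cases[of E True x y]) auto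
    have "(x, x) \<in> adj E ^^ (m + n)"
      using m(3) relpow_sym[OF sym_adj n(3)] by (auto simp: relpow_add)
    then have "(x, x) \<in> adj E ^^ l"
      by (rule closed_walk_pad[OF sym_adj]) (use m n le assms in auto)
    then show False
      using assms cycle_hom_iff_closed_walk[of V E l] by (auto simp: Forb_h_cycle_def odd_pos)
  qed
  then show ?thesis
    using assms even_odd_metric_space_walk_dist[of V E]
    by (auto simp: K_class_def Forb_h_cycle_def walk_dist_def)
qed

section \<open>Walks along pairs at odd distance one\<close>

context even_odd_metric_space
begin

lemma dist_le_walk:
  assumes "x \<in> S" "(x, y) \<in> adj (dist_one_edges S d) ^^ n"
  shows "y \<in> S \<and> (if even n then fst (d x y) else snd (d x y)) \<le> enat n"
  using assms(2)
proof (induction n arbitrary: y)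
  case 0
  then show ?case
    using assms(1) dist_zero_iff[of x x] by (auto simp: zero_enat_def)
next
  case (Suc n)
  then obtain w where w: "(x, w) \<in> adj (dist_one_edges S d) ^^ n"
    "(w, y) \<in> adj (dist_one_edges S d)" by auto
  have IH: "w \<in> S" "(if even n then fst (d x w) else snd (d x w)) \<le> enat n"
    using Suc.IH[OF w(1)] by auto
  have y: "y \<in> S" "snd (d w y) = 1"
    using w(2) dist_sym by (auto simp: adj_def dist_one_edges_def doubleton_eq_iff)
  have "eo_le (d x y) (eo_add (d x w) (d w y))"
    using assms(1) IH(1) y(1) by (intro dist_triangle)
  \<comment> \<open>An edge has odd component 1, so in each minimum of \<open>eo_add\<close> one
    term is the component of \<open>d x w\<close> of the opposite parity plus 1. This matches the
    change of parity from \<open>n\<close> to \<open>Suc n\<close>.\<close>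
  then have "fst (d x y) \<le> snd (d x w) + 1" "snd (d x y) \<le> fst (d x w) + 1"
    using y(2) by (auto simp: eo_le_def eo_add_def)
  moreover have "enat n + 1 = enat (Suc n)"
    by (simp add: one_enat_def)
  ultimately have "(if even n then snd (d x y) else fst (d x y)) \<le> enat (Suc n)"
    using add_right_mono[OF IH(2), of 1] by (simp split: if_splits)
  then show ?case
    using y(1) by (simp split: if_splits)
qed

end

lemma Forb_h_cycle_dist_one_edges:
  assumes "odd l" "K_class l U d"
  shows "Forb_h_cycle l U (dist_one_edges U d)"
proof -
  interpret even_odd_metric_space U d
    using assms by (simp add: K_class_def)
  have far: "\<not> a + b \<le> enat l" if "x \<in> U" "y \<in> U" "d x y = (a, b)" for x y a b
    using assms that by (auto simp: K_class_def)
  \<comment> \<open>The axioms of the metric allow the self-distance \<open>(0, 1)\<close>, which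
    would be a loop; the defining condition of the class excludes it, as
    \<open>0 + 1 \<le> l\<close>.\<close>
  have irrefl: "d x x \<noteq> (a, 1)" if "x \<in> U" for x a
  proof
    assume "d x x = (a, 1)"
    moreover from this have "a = 0"
      using that dist_zero_iff[of x x] by auto
    ultimately show False
      using far[of x x a 1] that odd_pos[OF assms(1)] by (simp add: one_enat_def)
  qed
  have simple: "simple_graph U (dist_one_edges U d)"
    unfolding simple_graph_def
  proof
    fix e assume "e \<in> dist_one_edges U d"
    then obtain x y a where "x \<in> U" "y \<in> U" "d x y = (a, 1)" "e = {x, y}"
      by (auto simp: dist_one_edges_def)
    moreover from this have "x \<noteq> y" using irrefl by auto
    ultimately show "\<exists>x\<in>U. \<exists>y\<in>U. x \<noteq> y \<and> e = {x, y}" by blast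
  qed
  have "(x, x) \<notin> adj (dist_one_edges U d) ^^ l" for x
  proof
    assume walk: "(x, x) \<in> adj (dist_one_edges U d) ^^ l"
    \<comment> \<open>The first edge of the walk shows that \<open>x\<close> lies in
      \<open>U\<close>, where the axioms of the metric apply.\<close>
    then obtain y where "(x, y) \<in> adj (dist_one_edges U d)"
      using odd_pos[OF assms(1)] by (metis gr0_conv_Suc relpow_Suc_D2)
    then have x: "x \<in> U"
      using adj_in_verts[OF simple] by blast
    then obtain b where "d x x = (0, b)"
      using dist_zero_iff[OF x x] by auto
    then show False
      using dist_le_walk[OF x walk] far[OF x x, of 0 b] assms(1) by simp
  qed
  then show ?thesis
    using simple assms cycle_hom_iff_closed_walk[OF simple odd_pos[OF assms(1)]]
    by (auto simp: Forb_h_cycle_def K_class_def)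
qed

section \<open>Embedding graphs as subgraphs\<close>

lemma graph_iso_image:
  assumes "simple_graph V E" "inj_on f V"
  shows "simple_graph (f ` V) ((`) f ` E)" "graph_iso V E (f ` V) ((`) f ` E) f"
proof -
  have sub: "e \<subseteq> V" if "e \<in> E" for e
    using assms(1) that by (auto simp: simple_graph_def)
  show "simple_graph (f ` V) ((`) f ` E)"
    unfolding simple_graph_def
  proof
    fix e assume "e \<in> (`) f ` E"
    then obtain e' where "e' \<in> E" "e = f ` e'" by blast
    then obtain x y where xy: "x \<in> V" "y \<in> V" "x \<noteq> y" "e = {f x, f y}"
      using assms(1) by (fastforce simp: simple_graph_def)
    then have "f x \<noteq> f y"
      using assms(2) by (simp add: inj_on_eq_iff)
    then show "\<exists>x\<in>f ` V. \<exists>y\<in>f ` V. x \<noteq> y \<and> e = {x, y}"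
      using xy by (intro bexI[of _ "f x"] bexI[of _ "f y"]) simp_all
  qed
  have "{x, y} \<in> E \<longleftrightarrow> {f x, f y} \<in> (`) f ` E" if "x \<in> V" "y \<in> V" for x y
  proof
    assume "{f x, f y} \<in> (`) f ` E"
    then obtain e where e: "e \<in> E" "f ` e = f ` {x, y}" by auto
    \<comment> \<open>Both edges lie in \<open>V\<close>, where \<open>f\<close> is injective, so
      equal images come from equal edges.\<close>
    then have "e = {x, y}"
      using inj_on_image_eq_iff[OF assms(2) sub[OF e(1)], of "{x, y}"] that by simp
    then show "{x, y} \<in> E" using e by simp
  qed (rule image_eqI[of _ _ "{x, y}"], simp_all)
  then show "graph_iso V E (f ` V) ((`) f ` E) f"
    using assms(2) by (simp add: graph_iso_def bij_betw_def)
qed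

theorem theorem8p18:
  fixes l :: nat and U :: "'a set" and d :: "'a \<Rightarrow> 'a \<Rightarrow> eo_pair"
  assumes "l \<ge> 3" and "odd l"
    and "generic_space l U d"
  shows "Forb_h_cycle l U (dist_one_edges U d) \<and>
    (\<forall>(V :: 'b set) E. Forb_h_cycle l V E \<longrightarrow>
       (\<exists>W F f. subgraph W F U (dist_one_edges U d) \<and> graph_iso V E W F f))"
proof (intro conjI allI impI)
  show "Forb_h_cycle l U (dist_one_edges U d)"
    using assms by (auto simp: generic_space_def intro: Forb_h_cycle_dist_one_edges)
next
  fix V :: "'b set" and E
  assume forb: "Forb_h_cycle l V E"
  then have simple: "simple_graph V E" by (simp add: Forb_h_cycle_def)
  obtain f where f: "f \<in> V \<rightarrow> U" "inj_on f V" "dist_preserving V (walk_dist E) d f"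
    using generic_space_embeds[OF assms(3) K_class_walk_dist[OF assms(2) forb]]
    by (auto simp: eo_embedding_def)
  \<comment> \<open>The odd component of the distance is 1 along an edge, and \<open>f\<close>
    preserves it.\<close>
  have "f ` e \<in> dist_one_edges U d" if e: "e \<in> E" for e
  proof -
    obtain x y where xy: "x \<in> V" "y \<in> V" "e = {x, y}"
      using simple e by (auto simp: simple_graph_def)
    then have "d (f x) (f y) = (walk_len E False x y, 1)"
      using f(3) e by (simp add: dist_preserving_def walk_dist_def walk_len_odd_one)
    then show ?thesis
      using xy f(1) by (auto simp: dist_one_edges_def)
  qed
  then have "subgraph (f ` V) ((`) f ` E) U (dist_one_edges U d)"
    using f graph_iso_image(1)[OF simple f(2)] by (auto simp: subgraph_def)
  then show "\<exists>W F f. subgraph W F U (dist_one_edges U d) \<and> graph_iso V E W F f"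
    using graph_iso_image(2)[OF simple f(2)] by blast
qed

end
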